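(* Let $G$ be a chordal graph and let $x$ be a vertex of $G$ such that $N[x]$ induces a clique on at least $2$ vertices. Let $A_1,\dots,A_a$ be the minimal monomial generators of $J(G\setminus N[x])$ and let $B_1,\dots,B_b$ be the minimal monomial generators of $J(G\setminus\{x\})$, both written in a linear quotients ordering. Let $B_{i_1},\dots,B_{i_k}$, with $i_1<\dots<i_k$, be those generators among $B_1,\dots,B_b$ which do not contain $N(x)$. Then $$N(x)A_1,\dots,N(x)A_a,\; xB_{i_1},\dots,xB_{i_k}$$ is a linear quotients ordering for $J(G)$.
   Context: All graphs are finite and simple. $N(v)$ is the set of neighbors of a vertex $v$ and $N[v]=N(v)\cup\{v\}$. For $A\subseteq V(G)$, $G\setminus A$ is the induced subgraph obtained by removing the vertices in $A$. A graph is chordal if it has no induced cycle of length greater than $3$. The vertices of a graph are identified with the variables of a polynomial ring over a field $\Bbbk$. A squarefree monomial is identified with the set of variables (vertices) dividing it, and a set of vertices with the product of its elements; thus "$B$ does not contain $N(x)$" means $N(x)\nsubseteq B$, and $N(x)A$ denotes the monomial $\left(\prod_{y\in N(x)}y\right)\cdot A$. A vertex cover of a graph is a set of vertices meeting every edge; it is minimal if no proper subset is a vertex cover; the only minimal vertex cover of a graph with no edges is $\emptyset$ (corresponding to the monomial $1$). The cover ideal $J(G)$ is the ideal generated by the monomials $\prod_{z\in C}z$ with $C$ a minimal vertex cover of $G$. An ordering $m_1,\dots,m_q$ of the minimal monomial generators of a monomial ideal $I$ is a linear quotients ordering for $I$ if for every $i=2,\dots,q$ the colon ideal $(m_1,\dots,m_{i-1}):m_i$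 is generated by a subset of the variables. *)

theory Defs
  imports
    "Graph_Theory.Graph_Theory"
    "HOL-Library.Poly_Mapping"
    "HOL-Algebra.Ideal"
begin

section \<open>Graphs\<close>

text \<open>
  A finite simple graph is a \<open>graph\<close> in the sense of the Graph\_Theory entry: a finite, loop-free
  symmetric digraph without parallel arcs. An undirected edge \<open>{u, v}\<close> is the pair of
  adjacencies \<open>u \<rightarrow>\<^bsub>G\<^esub> v\<close> and \<open>v \<rightarrow>\<^bsub>G\<^esub> u\<close>.
\<close>

definition nbhd :: "('v, 'e) pre_digraph \<Rightarrow> 'v \<Rightarrow> 'v set" where
  "nbhd G v = {w. v \<rightarrow>\<^bsub>G\<^esub> w}"

definition closed_nbhd :: "('v, 'e) pre_digraph \<Rightarrow> 'v \<Rightarrow> 'v set" where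
  "closed_nbhd G v = nbhd G v \<union> {v}"

definition remove_verts :: "('v, 'e) pre_digraph \<Rightarrow> 'v set \<Rightarrow> ('v, 'e) pre_digraph" where
  "remove_verts G A = G \<restriction> (verts G - A)"

text \<open>
  The list \<open>p\<close> enumerates the vertices of an induced cycle of \<open>G\<close> in cyclic order: two entries
  are adjacent in \<open>G\<close> exactly if they are cyclically consecutive.
\<close>
definition induced_cycle :: "('v, 'e) pre_digraph \<Rightarrow> 'v list \<Rightarrow> bool" where
  "induced_cycle G p \<longleftrightarrow> length p \<ge> 3 \<and> distinct p \<and> set p \<subseteq> verts G \<and>
     (\<forall>i < length p. \<forall>j < length p.
        (p ! i \<rightarrow>\<^bsub>G\<^esub> p ! j) \<longleftrightarrow> j = Suc i mod length p \<or> i = Suc j mod length p)"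

definition chordal :: "('v, 'e) pre_digraph \<Rightarrow> bool" where
  "chordal G \<longleftrightarrow> \<not> (\<exists>p. induced_cycle G p \<and> length p > 3)"

definition vertex_cover :: "('v, 'e) pre_digraph \<Rightarrow> 'v set \<Rightarrow> bool" where
  "vertex_cover G C \<longleftrightarrow> C \<subseteq> verts G \<and> (\<forall>u v. u \<rightarrow>\<^bsub>G\<^esub> v \<longrightarrow> u \<in> C \<or> v \<in> C)"

definition minimal_vertex_cover :: "('v, 'e) pre_digraph \<Rightarrow> 'v set \<Rightarrow> bool" where
  "minimal_vertex_cover G C \<longleftrightarrow> vertex_cover G C \<and> (\<forall>D. D \<subset> C \<longrightarrow> \<not> vertex_cover G D)"


section \<open>Polynomial rings and monomial ideals\<close>

text \<open>
  Polynomials are finitely supported functions from exponent vectors \<open>'v \<Rightarrow>\<^sub>0 nat\<close> to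
  coefficients.
\<close>
type_synonym ('v, 'k) mpoly = "('v \<Rightarrow>\<^sub>0 nat) \<Rightarrow>\<^sub>0 'k"

definition Var :: "'v \<Rightarrow> ('v, 'k::field) mpoly" where
  "Var v = Poly_Mapping.single (Poly_Mapping.single v 1) 1"

text \<open>The polynomial ring over the field \<open>'k\<close> whose variables are the elements of \<open>X\<close>.\<close>
definition poly_ring :: "'v set \<Rightarrow> ('v, 'k::field) mpoly ring" where
  "poly_ring X = \<lparr>carrier = {p. \<forall>m \<in> Poly_Mapping.keys p. Poly_Mapping.keys m \<subseteq> X},
     monoid.mult = (*), one = 1, ring.zero = 0, add = (+)\<rparr>"

definition monomials :: "'v set \<Rightarrow> ('v, 'k::field) mpoly set" where
  "monomials X = {Poly_Mapping.single m 1 | m. Poly_Mapping.keys m \<subseteq> X}"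

text \<open>The squarefree monomial identified with a finite set of variables, and conversely.\<close>
definition set_monomial :: "'v set \<Rightarrow> ('v, 'k::field) mpoly" where
  "set_monomial A = (\<Prod>v\<in>A. Var v)"

definition monomial_set :: "('v, 'k::field) mpoly \<Rightarrow> 'v set" where
  "monomial_set m = {v. Var v dvd m}"

definition colon_ideal ::
    "'v set \<Rightarrow> ('v, 'k::field) mpoly set \<Rightarrow> ('v, 'k) mpoly \<Rightarrow> ('v, 'k) mpoly set" where
  "colon_ideal X I m = {f \<in> carrier (poly_ring X). f * m \<in> I}"

definition minimal_monomial_generators ::
    "'v set \<Rightarrow> ('v, 'k::field) mpoly set \<Rightarrow> ('v, 'k) mpoly set \<Rightarrow> bool" where
  "minimal_monomial_generators X I M \<longleftrightarrow>
     M \<subseteq> monomials X \<and> genideal (poly_ring X) M = I \<and>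
     (\<forall>M'. M' \<subset> M \<longrightarrow> genideal (poly_ring X) M' \<noteq> I)"

text \<open>The generators are indexed from \<open>0\<close>, so \<open>take i ms\<close> lists the predecessors of \<open>ms ! i\<close>.\<close>
definition linear_quotients_ordering ::
    "'v set \<Rightarrow> ('v, 'k::field) mpoly set \<Rightarrow> ('v, 'k) mpoly list \<Rightarrow> bool" where
  "linear_quotients_ordering X I ms \<longleftrightarrow>
     distinct ms \<and> minimal_monomial_generators X I (set ms) \<and>
     (\<forall>i. 1 \<le> i \<and> i < length ms \<longrightarrow>
       (\<exists>Z \<subseteq> X. colon_ideal X (genideal (poly_ring X) (set (take i ms))) (ms ! i) =
          genideal (poly_ring X) (Var ` Z)))"

text \<open>The cover ideal lives in the polynomial ring whose variables are the vertices of \<open>G\<close>.\<close>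
definition cover_ideal :: "('v, 'e) pre_digraph \<Rightarrow> ('v, 'k::field) mpoly set" where
  "cover_ideal G = genideal (poly_ring (verts G)) {set_monomial C | C. minimal_vertex_cover G C}"

end

(*
  A monomial lies in a monomial ideal iff some generator divides it, so for squarefree monomials the
  linear quotients condition becomes a condition on sets: the
  colon ideal of a member D is generated by the variables in Z iff the sets S meeting Z are exactly
  those for which some earlier C is contained in the union of S and D.

  A minimal vertex cover of G either misses x, and is then N(x) together with a minimal cover of
  G - N[x], or contains x, and is then x together with a minimal cover B of G - x not containing
  N(x). In the second case B misses exactly one vertex y of the clique N(x). All N(x)A contain y, and
  yB contains some N(x)A, so they contribute exactly the variable y to the colon ideal of xB. Each
  variable z in the colon ideal of B comes from some earlier D contained in zB; if D contains N(x),
  it was dropped from the list, but then z = y, so no variable is lost.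
*)
theory Submission
  imports Defs
begin

lemma carrier_poly_ring:
  "carrier (poly_ring X) = {p. \<forall>m \<in> Poly_Mapping.keys p. Poly_Mapping.keys m \<subseteq> X}"
  by (simp add: poly_ring_def)

lemma poly_ring_mult [simp]: "f \<otimes>\<^bsub>poly_ring X\<^esub> g = f * g"
  and poly_ring_add [simp]: "f \<oplus>\<^bsub>poly_ring X\<^esub> g = f + g"
  and poly_ring_zero [simp]: "\<zero>\<^bsub>poly_ring X\<^esub> = 0"
  and poly_ring_one [simp]: "\<one>\<^bsub>poly_ring X\<^esub> = 1"
  by (simp_all add: poly_ring_def)

lemma keys_add_exponents:
  fixes a b :: "'v \<Rightarrow>\<^sub>0 nat"
  shows "Poly_Mapping.keys (a + b) = Poly_Mapping.keys a \<union> Poly_Mapping.keys b"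
  by (auto simp: in_keys_iff lookup_add)

lemma cring_poly_ring: "cring (poly_ring X :: ('v, 'k::field) mpoly ring)"
proof (rule cringI)
  let ?R = "poly_ring X :: ('v, 'k) mpoly ring"
  show "abelian_group ?R"
  proof (rule abelian_groupI)
    fix f g :: "('v, 'k) mpoly"
    assume "f \<in> carrier ?R" "g \<in> carrier ?R"
    then show "f \<oplus>\<^bsub>?R\<^esub> g \<in> carrier ?R"
      using Poly_Mapping.keys_add[of f g] by (auto simp: carrier_poly_ring)
  next
    fix f :: "('v, 'k) mpoly"
    assume "f \<in> carrier ?R"
    then have "- f \<in> carrier ?R" "- f \<oplus>\<^bsub>?R\<^esub> f = \<zero>\<^bsub>?R\<^esub>"
      by (auto simp: carrier_poly_ring in_keys_iff)
    then show "\<exists>g\<in>carrier ?R. g \<oplus>\<^bsub>?R\<^esub> f = \<zero>\<^bsub>?R\<^esub>" by blast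
  qed (auto simp: carrier_poly_ring algebra_simps)
  show "comm_monoid ?R"
  proof (rule comm_monoidI)
    fix f g :: "('v, 'k) mpoly"
    assume "f \<in> carrier ?R" "g \<in> carrier ?R"
    then show "f \<otimes>\<^bsub>?R\<^esub> g \<in> carrier ?R"
      using Poly_Mapping.keys_mult[of f g]
      by (auto simp: carrier_poly_ring keys_add_exponents dest!: subsetD)
  qed (auto simp: carrier_poly_ring algebra_simps)
qed (auto simp: algebra_simps)

definition exp_le :: "('v \<Rightarrow>\<^sub>0 nat) \<Rightarrow> ('v \<Rightarrow>\<^sub>0 nat) \<Rightarrow> bool" where
  "exp_le e m \<longleftrightarrow> (\<forall>v. Poly_Mapping.lookup e v \<le> Poly_Mapping.lookup m v)"

lemma exp_le_refl [simp]: "exp_le e e"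
  by (simp add: exp_le_def)

lemma exp_le_trans: "exp_le a b \<Longrightarrow> exp_le b c \<Longrightarrow> exp_le a c"
  by (meson exp_le_def le_trans)

lemma exp_le_antisym: "exp_le a b \<Longrightarrow> exp_le b a \<Longrightarrow> a = b"
  by (auto simp: exp_le_def intro!: poly_mapping_eqI antisym)

lemma exp_le_iff_add: "exp_le e m \<longleftrightarrow> (\<exists>d. m = e + d)"
proof
  assume "exp_le e m"
  then have "m = e + (m - e)"
    by (intro poly_mapping_eqI) (simp add: exp_le_def lookup_add lookup_minus)
  then show "\<exists>d. m = e + d" ..
qed (auto simp: exp_le_def lookup_add)

abbreviation monomial :: "('v \<Rightarrow>\<^sub>0 nat) \<Rightarrow> ('v, 'k::field) mpoly" where
  "monomial e \<equiv> Poly_Mapping.single e 1"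

lemma monomial_eq_iff [simp]: "(monomial e :: ('v, 'k::field) mpoly) = monomial d \<longleftrightarrow> e = d"
  by (metis keys_single singleton_inject zero_neq_one)

lemma poly_mapping_sum_single:
  fixes f :: "'a \<Rightarrow>\<^sub>0 'b::comm_monoid_add"
  shows "(\<Sum>m\<in>Poly_Mapping.keys f. Poly_Mapping.single m (Poly_Mapping.lookup f m)) = f"
  by (rule poly_mapping_eqI)
     (auto simp: lookup_sum lookup_single when_def in_keys_iff)

lemma genideal_monomials:
  fixes E :: "('v \<Rightarrow>\<^sub>0 nat) set"
  assumes E: "\<forall>e\<in>E. Poly_Mapping.keys e \<subseteq> X"
  shows "genideal (poly_ring X :: ('v, 'k::field) mpoly ring) (monomial ` E) =
    {f. \<forall>m\<in>Poly_Mapping.keys f. Poly_Mapping.keys m \<subseteq> X \<and> (\<exists>e\<in>E. exp_le e m)}"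
    (is "genideal ?R ?M = ?I")
proof
  interpret R: cring ?R by (rule cring_poly_ring)
  have "ideal ?I ?R"
  proof (rule idealI)
    show "ring ?R" by (rule R.ring_axioms)
    have mult: "f * g \<in> ?I" if f: "f \<in> ?I" and g: "g \<in> carrier ?R" for f g
    proof -
      have "Poly_Mapping.keys m \<subseteq> X \<and> (\<exists>e\<in>E. exp_le e m)" if "m \<in> Poly_Mapping.keys (f * g)" for m
      proof -
        from that obtain a b where m: "m = a + b" "a \<in> Poly_Mapping.keys f" "b \<in> Poly_Mapping.keys g"
          using Poly_Mapping.keys_mult[of f g] by blast
        moreover have "exp_le a m" using m exp_le_iff_add by blast
        ultimately show ?thesis
          using f g by (auto simp: carrier_poly_ring keys_add_exponents intro: exp_le_trans dest!: bspec)
      qed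
      then show ?thesis by blast
    qed
    show "f \<otimes>\<^bsub>?R\<^esub> g \<in> ?I" if "f \<in> ?I" "g \<in> carrier ?R" for f g
      using mult[OF that] by simp
    show "g \<otimes>\<^bsub>?R\<^esub> f \<in> ?I" if "f \<in> ?I" "g \<in> carrier ?R" for f g
      using mult[OF that] by (simp add: mult.commute)
    have minus: "inv\<^bsub>add_monoid ?R\<^esub> f = - f" if "f \<in> carrier ?R" for f
    proof -
      have "- f \<in> carrier ?R" using that by (auto simp: carrier_poly_ring in_keys_iff)
      with that show ?thesis
        using R.minus_equality[of "- f" f] by (simp add: a_inv_def)
    qed
    show "subgroup ?I (add_monoid ?R)"
    proof (rule group.subgroupI)
      show "Group.group (add_monoid ?R)" by (rule R.a_group)
      show sub: "?I \<subseteq> carrier (add_monoid ?R)" by (auto simp: carrier_poly_ring)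
      have "0 \<in> ?I" by simp
      then show "?I \<noteq> {}" by blast
      show "inv\<^bsub>add_monoid ?R\<^esub> f \<in> ?I" if "f \<in> ?I" for f
      proof -
        have "f \<in> carrier ?R" using sub that by auto
        then show ?thesis using that minus by (simp add: in_keys_iff)
      qed
      show "f \<otimes>\<^bsub>add_monoid ?R\<^esub> g \<in> ?I" if "f \<in> ?I" "g \<in> ?I" for f g
        using that Poly_Mapping.keys_add[of f g] by auto
    qed
  qed
  moreover have "?M \<subseteq> ?I" using E by (force intro: exp_le_refl)
  ultimately show "genideal ?R ?M \<subseteq> ?I" by (rule R.genideal_minimal)
  have "?M \<subseteq> carrier ?R" using E by (auto simp: carrier_poly_ring)
  note id = R.genideal_ideal[OF this] R.genideal_self[OF this]
  interpret I: ideal "genideal ?R ?M" ?R by (rule id)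
  show "?I \<subseteq> genideal ?R ?M"
  proof
    fix f assume f: "f \<in> ?I"
    have term_mem: "Poly_Mapping.single m (Poly_Mapping.lookup f m) \<in> genideal ?R ?M"
      if m: "m \<in> Poly_Mapping.keys f" for m
    proof -
      obtain e d where e: "e \<in> E" "m = e + d" using f m by (auto simp: exp_le_iff_add dest!: bspec)
      have "Poly_Mapping.keys m \<subseteq> X" using f m by blast
      then have "Poly_Mapping.single d (Poly_Mapping.lookup f m) \<in> carrier ?R"
        using e by (auto simp: carrier_poly_ring keys_add_exponents)
      moreover have "monomial e \<in> genideal ?R ?M" using id(2) e by blast
      ultimately show ?thesis
        using I.I_r_closed[of "monomial e" "Poly_Mapping.single d (Poly_Mapping.lookup f m)"] e
        by (simp add: mult_single)
    qed
    have "(\<Sum>m\<in>K. Poly_Mapping.single m (Poly_Mapping.lookup f m)) \<in> genideal ?R ?M"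
      if "finite K" "K \<subseteq> Poly_Mapping.keys f" for K
      using that
    proof (induction K)
      case empty
      then show ?case using additive_subgroup.zero_closed[OF I.is_additive_subgroup] by simp
    next
      case (insert m K)
      then show ?case
        using additive_subgroup.a_closed[OF I.is_additive_subgroup term_mem[of m]] by simp
    qed
    from this[of "Poly_Mapping.keys f"] show "f \<in> genideal ?R ?M"
      by (simp add: poly_mapping_sum_single)
  qed
qed

lemma monomial_in_genideal:
  fixes E :: "('v \<Rightarrow>\<^sub>0 nat) set"
  assumes "\<forall>e\<in>E. Poly_Mapping.keys e \<subseteq> X"
  shows "(monomial m :: ('v, 'k::field) mpoly) \<in> genideal (poly_ring X) (monomial ` E) \<longleftrightarrow>
    Poly_Mapping.keys m \<subseteq> X \<and> (\<exists>e\<in>E. exp_le e m)"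
  by (simp add: genideal_monomials[OF assms])

lemma keys_mult_monomial:
  "Poly_Mapping.keys (f * monomial e :: ('v, 'k::field) mpoly) = (\<lambda>m. m + e) ` Poly_Mapping.keys f"
proof -
  have "Poly_Mapping.lookup (f * monomial e) (m + e) = Poly_Mapping.lookup f m" for m
  proof -
    have "Poly_Mapping.lookup (g * monomial e) (m + e) = Poly_Mapping.lookup g m"
      if "finite K" "g = (\<Sum>k\<in>K. Poly_Mapping.single k (Poly_Mapping.lookup f k))" for K g
      using that
      by (simp add: sum_distrib_right mult_single lookup_sum lookup_single when_def)
    from this[OF finite_keys poly_mapping_sum_single[symmetric]] show ?thesis .
  qed
  moreover have "Poly_Mapping.keys (f * monomial e) \<subseteq> (\<lambda>m. m + e) ` Poly_Mapping.keys f"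
    using Poly_Mapping.keys_mult[of f "monomial e"] by auto
  ultimately show ?thesis by (auto simp: in_keys_iff)
qed

definition set_exp :: "'v set \<Rightarrow> ('v \<Rightarrow>\<^sub>0 nat)" where
  "set_exp A = (\<Sum>v\<in>A. Poly_Mapping.single v 1)"

lemma lookup_set_exp:
  "finite A \<Longrightarrow> Poly_Mapping.lookup (set_exp A) v = (if v \<in> A then 1 else 0)"
  by (simp add: set_exp_def lookup_sum lookup_single when_def)

lemma keys_set_exp [simp]: "finite A \<Longrightarrow> Poly_Mapping.keys (set_exp A) = A"
  by (auto simp: in_keys_iff lookup_set_exp split: if_splits)

lemma set_monomial_eq: "set_monomial A = monomial (set_exp A)"
proof (cases "finite A")
  case True
  then show ?thesis
    by (induction A) (simp_all add: set_monomial_def set_exp_def Var_def mult_single)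
qed (simp add: set_monomial_def set_exp_def)

lemma set_exp_le_iff: "finite A \<Longrightarrow> exp_le (set_exp A) m \<longleftrightarrow> A \<subseteq> Poly_Mapping.keys m"
  by (auto simp: exp_le_def lookup_set_exp in_keys_iff Suc_le_eq)

lemma set_exp_le_add_iff:
  "finite A \<Longrightarrow> finite B \<Longrightarrow>
    exp_le (set_exp A) (m + set_exp B) \<longleftrightarrow> A \<subseteq> Poly_Mapping.keys m \<union> B"
  by (simp add: set_exp_le_iff keys_add_exponents)

lemma set_exp_inject: "finite A \<Longrightarrow> finite B \<Longrightarrow> set_exp A = set_exp B \<longleftrightarrow> A = B"
  by (metis keys_set_exp)

lemma set_monomial_inject:
  "finite A \<Longrightarrow> finite B \<Longrightarrow>
    (set_monomial A :: ('v, 'k::field) mpoly) = set_monomial B \<longleftrightarrow> A = B"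
  by (simp add: set_monomial_eq set_exp_inject)

lemma set_monomial_mult:
  "finite A \<Longrightarrow> finite B \<Longrightarrow> A \<inter> B = {} \<Longrightarrow>
    set_monomial A * set_monomial B = set_monomial (A \<union> B)"
  by (simp add: set_monomial_def prod.union_disjoint)

lemma Var_mult_set_monomial:
  "finite A \<Longrightarrow> v \<notin> A \<Longrightarrow> Var v * set_monomial A = set_monomial (insert v A)"
  by (simp add: set_monomial_def)

lemma monomial_set_set_monomial:
  assumes "finite A"
  shows "monomial_set (set_monomial A :: ('v, 'k::field) mpoly) = A"
proof -
  have "v \<in> A" if "Var v dvd (set_monomial A :: ('v, 'k) mpoly)" for v
  proof -
    from that obtain q :: "('v, 'k) mpoly" where "monomial (set_exp A) = q * Var v"
      by (metis set_monomial_eq dvdE mult.commute)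
    then have "set_exp A \<in> Poly_Mapping.keys (q * monomial (Poly_Mapping.single v 1))"
      by (metis Var_def keys_single singletonI zero_neq_one)
    then obtain m where "set_exp A = m + Poly_Mapping.single v 1"
      unfolding keys_mult_monomial by blast
    then have "Poly_Mapping.keys (set_exp A) = Poly_Mapping.keys m \<union> {v}"
      by (simp add: keys_add_exponents)
    with assms show ?thesis by auto
  qed
  then show ?thesis
    using assms by (auto simp: monomial_set_def set_monomial_def intro: dvd_prodI)
qed

(* The index i = 0 imposes no condition, since Z = {} works. *)
definition linear_quotients_sets :: "'v set \<Rightarrow> 'v set list \<Rightarrow> bool" where
  "linear_quotients_sets X Cs \<longleftrightarrow> (\<forall>i < length Cs. \<exists>Z \<subseteq> X. \<forall>S \<subseteq> X.
     (\<exists>C \<in> set (take i Cs). C \<subseteq> S \<union> Cs ! i) \<longleftrightarrow> S \<inter> Z \<noteq> {})"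

lemma colon_ideal_set_monomials:
  fixes P :: "'v set set"
  assumes X: "finite X" and P: "P \<subseteq> Pow X" and A: "A \<subseteq> X"
  shows "colon_ideal X (genideal (poly_ring X) (set_monomial ` P)) (set_monomial A) =
    {f :: ('v, 'k::field) mpoly. \<forall>m\<in>Poly_Mapping.keys f.
      Poly_Mapping.keys m \<subseteq> X \<and> (\<exists>C\<in>P. C \<subseteq> Poly_Mapping.keys m \<union> A)}"
proof -
  have fin: "finite C" if "C \<in> P" for C
    using that P X by (meson PowD finite_subset subsetD)
  have finA: "finite A" using A X by (rule finite_subset)
  have im: "set_monomial ` P = (monomial ` set_exp ` P :: ('v, 'k) mpoly set)"
    by (auto simp: set_monomial_eq)
  have "\<forall>e \<in> set_exp ` P. Poly_Mapping.keys e \<subseteq> X" using fin P by (auto simp: Pow_def)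
  note gen = genideal_monomials[OF this]
  show ?thesis
    unfolding colon_ideal_def carrier_poly_ring im gen
    by (auto simp: set_monomial_eq keys_mult_monomial keys_add_exponents finA fin A
        set_exp_le_add_iff)
qed

lemma genideal_Vars:
  assumes "Z \<subseteq> X"
  shows "genideal (poly_ring X) (Var ` Z) =
    {f :: ('v, 'k::field) mpoly. \<forall>m\<in>Poly_Mapping.keys f.
      Poly_Mapping.keys m \<subseteq> X \<and> Poly_Mapping.keys m \<inter> Z \<noteq> {}}"
proof -
  have im: "Var ` Z = (monomial ` (\<lambda>v. Poly_Mapping.single v 1) ` Z :: ('v, 'k) mpoly set)"
    by (auto simp: Var_def)
  have "exp_le (Poly_Mapping.single v 1) m \<longleftrightarrow> v \<in> Poly_Mapping.keys m" for v :: 'v and m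
    using set_exp_le_iff[of "{v}" m] by (simp add: set_exp_def)
  moreover have kZ: "\<forall>e \<in> (\<lambda>v. Poly_Mapping.single v (1::nat)) ` Z. Poly_Mapping.keys e \<subseteq> X"
    using assms by auto
  ultimately show ?thesis
    unfolding im genideal_monomials[OF kZ] bex_simps(7) disjoint_iff by (simp add: disjoint_iff) blast
qed

lemma minimal_monomial_generators_unique:
  fixes F :: "'v set set" and M :: "('v, 'k::field) mpoly set"
  assumes X: "finite X" and F: "F \<subseteq> Pow X"
    and anti: "\<forall>C\<in>F. \<forall>D\<in>F. C \<subseteq> D \<longrightarrow> C = D"
  shows "minimal_monomial_generators X (genideal (poly_ring X) (set_monomial ` F)) M \<longleftrightarrow>
    M = set_monomial ` F" (is "minimal_monomial_generators X ?I M \<longleftrightarrow> _")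
proof -
  have fin: "finite C" if "C \<in> F" for C
    using that F X by (meson PowD finite_subset subsetD)
  have im: "set_monomial ` F = (monomial ` set_exp ` F :: ('v, 'k) mpoly set)"
    by (auto simp: set_monomial_eq)
  have kF: "\<forall>e \<in> set_exp ` F. Poly_Mapping.keys e \<subseteq> X" using fin F by auto
  note memF = monomial_in_genideal[OF kF]
  have set_exp_le_eq: "D = C" if "D \<in> F" "C \<in> F" "exp_le (set_exp D) (set_exp C)" for C D
    using that anti fin by (simp add: set_exp_le_iff)
  show ?thesis
  proof
    assume M: "M = set_monomial ` F"
    show "minimal_monomial_generators X ?I M"
      unfolding minimal_monomial_generators_def
    proof (intro conjI allI impI)
      show "M \<subseteq> monomials X" using kF by (auto simp: M im monomials_def)
      show "genideal (poly_ring X) M = ?I" by (simp add: M)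
      fix M' assume M': "M' \<subset> M"
      then obtain C where C: "C \<in> F" "set_monomial C \<notin> M'" using M by blast
      define F' where "F' = {D \<in> F. set_monomial D \<in> M'}"
      have M'_eq: "M' = monomial ` set_exp ` F'"
        using M' by (auto simp: M F'_def set_monomial_eq)
      have "F' \<subseteq> F" by (auto simp: F'_def)
      then have "\<forall>e \<in> set_exp ` F'. Poly_Mapping.keys e \<subseteq> X" using kF by blast
      note mem' = monomial_in_genideal[OF this]
      have "set_monomial C \<in> ?I"
        unfolding im set_monomial_eq memF using C kF exp_le_refl by blast
      moreover have "set_monomial C \<notin> genideal (poly_ring X) M'"
      proof
        assume "set_monomial C \<in> genideal (poly_ring X) M'"
        then obtain D where D: "D \<in> F'" "exp_le (set_exp D) (set_exp C)"
          by (auto simp: set_monomial_eq M'_eq mem')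
        then have "D = C" using C(1) \<open>F' \<subseteq> F\<close> set_exp_le_eq by (meson subsetD)
        with C D show False by (simp add: F'_def)
      qed
      ultimately show "genideal (poly_ring X) M' \<noteq> ?I" by blast
    qed
  next
    assume min: "minimal_monomial_generators X ?I M"
    define E where "E = {e. Poly_Mapping.keys e \<subseteq> X \<and> monomial e \<in> M}"
    have M_eq: "M = monomial ` E"
      using min by (auto simp: minimal_monomial_generators_def monomials_def E_def)
    have kE: "\<forall>e \<in> E. Poly_Mapping.keys e \<subseteq> X" by (simp add: E_def)
    note memE = monomial_in_genideal[OF kE]
    have gen: "genideal (poly_ring X) (monomial ` E) = ?I"
      using min M_eq by (auto simp: minimal_monomial_generators_def)
    have upset: "(\<exists>e\<in>E. exp_le e m) \<longleftrightarrow> (\<exists>C\<in>F. exp_le (set_exp C) m)"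
      if "Poly_Mapping.keys m \<subseteq> X" for m
      using memE[of m] memF[of m] that gen by (auto simp: im)
    have E_anti: "e' = e" if "e \<in> E" "e' \<in> E" "exp_le e' e" for e e'
    proof (rule ccontr)
      assume ne: "e' \<noteq> e"
      have kE': "\<forall>d \<in> E - {e}. Poly_Mapping.keys d \<subseteq> X" using kE by blast
      have "(\<exists>d\<in>E - {e}. exp_le d m) \<longleftrightarrow> (\<exists>d\<in>E. exp_le d m)" for m
        using that ne by (metis Diff_iff exp_le_trans singletonD)
      then have "genideal (poly_ring X) (monomial ` (E - {e})) =
          (genideal (poly_ring X) (monomial ` E) :: ('v, 'k) mpoly set)"
        using genideal_monomials[OF kE', where 'k='k] genideal_monomials[OF kE, where 'k='k] by simp
      moreover have "monomial e \<in> M" "monomial e \<notin> monomial ` (E - {e})"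
        using that M_eq by (auto simp: image_iff)
      then have "monomial ` (E - {e}) \<subset> M" using M_eq by blast
      ultimately show False using min gen by (auto simp: minimal_monomial_generators_def)
    qed
    have "E = set_exp ` F"
    proof
      show "E \<subseteq> set_exp ` F"
      proof
        fix e assume e: "e \<in> E"
        then obtain C where C: "C \<in> F" "exp_le (set_exp C) e"
          using upset[of e] kE exp_le_refl by blast
        then obtain e' where e': "e' \<in> E" "exp_le e' (set_exp C)"
          using upset[of "set_exp C"] kF exp_le_refl by blast
        then have "e' = e" using E_anti[OF e e'(1)] C exp_le_trans by blast
        then have "e = set_exp C" using C e' exp_le_antisym by blast
        with C show "e \<in> set_exp ` F" by blast
      qed
      show "set_exp ` F \<subseteq> E"
      proof
        fix d assume "d \<in> set_exp ` F"
        then obtain C where C: "C \<in> F" "d = set_exp C" by blast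
        then obtain e where e: "e \<in> E" "exp_le e d"
          using upset[of "set_exp C"] kF exp_le_refl by blast
        then obtain D where D: "D \<in> F" "exp_le (set_exp D) e"
          using upset[of e] kE exp_le_refl by blast
        then have "exp_le (set_exp D) (set_exp C)" using e C exp_le_trans by blast
        then have "D = C" using D C set_exp_le_eq by blast
        then have "e = d" using e D C exp_le_antisym by blast
        with e show "d \<in> E" by simp
      qed
    qed
    then show "M = set_monomial ` F" by (simp add: M_eq im)
  qed
qed

lemma linear_quotients_ordering_set_monomials:
  fixes Cs :: "'v set list"
  assumes X: "finite X" and F: "F \<subseteq> Pow X"
    and anti: "\<forall>C\<in>F. \<forall>D\<in>F. C \<subseteq> D \<longrightarrow> C = D"
    and Cs: "set Cs \<subseteq> Pow X"
  shows "linear_quotients_ordering X (genideal (poly_ring X) (set_monomial ` F))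
      (map set_monomial Cs :: ('v, 'k::field) mpoly list) \<longleftrightarrow>
    distinct Cs \<and> set Cs = F \<and> linear_quotients_sets X Cs"
proof -
  have inj: "inj_on (set_monomial :: _ \<Rightarrow> ('v, 'k) mpoly) (Pow X)"
    using X by (auto intro!: inj_onI simp: set_monomial_inject finite_subset)
  have step: "colon_ideal X (genideal (poly_ring X) (set (take i (map set_monomial Cs))))
        (map set_monomial Cs ! i) = (genideal (poly_ring X) (Var ` Z) :: ('v, 'k) mpoly set) \<longleftrightarrow>
      (\<forall>S\<subseteq>X. (\<exists>C\<in>set (take i Cs). C \<subseteq> S \<union> Cs ! i) \<longleftrightarrow> S \<inter> Z \<noteq> {})" (is "?L = ?G \<longleftrightarrow> ?R")
    if "i < length Cs" "Z \<subseteq> X" for i Z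
  proof -
    have P: "set (take i Cs) \<subseteq> Pow X" using Cs set_take_subset by fast
    have A: "Cs ! i \<subseteq> X" using Cs that nth_mem by blast
    have L: "?L = {f. \<forall>m\<in>Poly_Mapping.keys f.
        Poly_Mapping.keys m \<subseteq> X \<and> (\<exists>C\<in>set (take i Cs). C \<subseteq> Poly_Mapping.keys m \<union> Cs ! i)}"
      using colon_ideal_set_monomials[OF X P A, where 'k='k] that by (simp add: take_map)
    have G: "?G = {f. \<forall>m\<in>Poly_Mapping.keys f.
        Poly_Mapping.keys m \<subseteq> X \<and> Poly_Mapping.keys m \<inter> Z \<noteq> {}}"
      by (rule genideal_Vars[OF that(2)])
    show ?thesis
    proof
      assume eq: "?L = ?G"
      show ?R
      proof (intro allI impI)
        fix S assume S: "S \<subseteq> X"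
        then have "finite S" using X finite_subset by blast
        have "monomial (set_exp S) \<in> ?L \<longleftrightarrow> monomial (set_exp S) \<in> ?G" using eq by simp
        then show "(\<exists>C\<in>set (take i Cs). C \<subseteq> S \<union> Cs ! i) \<longleftrightarrow> S \<inter> Z \<noteq> {}"
          unfolding L G using S \<open>finite S\<close> by simp
      qed
    next
      assume ?R
      then show "?L = ?G" unfolding L G by (simp cong: conj_cong)
    qed
  qed
  have first: "\<exists>Z\<subseteq>X. \<forall>S\<subseteq>X. (\<exists>C\<in>set (take 0 Cs). C \<subseteq> S \<union> Cs ! 0) \<longleftrightarrow> S \<inter> Z \<noteq> {}"
    by (intro exI[of _ "{}"]) simp
  have "(\<forall>i. 1 \<le> i \<and> i < length (map set_monomial Cs :: ('v, 'k) mpoly list) \<longrightarrow>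
      (\<exists>Z\<subseteq>X. colon_ideal X (genideal (poly_ring X) (set (take i (map set_monomial Cs))))
        (map set_monomial Cs ! i) = (genideal (poly_ring X) (Var ` Z) :: ('v, 'k) mpoly set)))
    \<longleftrightarrow> linear_quotients_sets X Cs" (is "?lq \<longleftrightarrow> _")
    unfolding linear_quotients_sets_def
  proof (intro iffI allI impI)
    fix i assume "i < length Cs" and *: ?lq
    show "\<exists>Z\<subseteq>X. \<forall>S\<subseteq>X. (\<exists>C\<in>set (take i Cs). C \<subseteq> S \<union> Cs ! i) \<longleftrightarrow> S \<inter> Z \<noteq> {}"
    proof (cases "i = 0")
      case True
      then show ?thesis using first by simp
    next
      case False
      then show ?thesis using * step[OF \<open>i < length Cs\<close>] \<open>i < length Cs\<close>
        by (metis One_nat_def Suc_leI length_map not_gr_zero)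
    qed
  next
    fix i assume *: "\<forall>i<length Cs. \<exists>Z\<subseteq>X. \<forall>S\<subseteq>X. (\<exists>C\<in>set (take i Cs). C \<subseteq> S \<union> Cs ! i) \<longleftrightarrow> S \<inter> Z \<noteq> {}"
      and "1 \<le> i \<and> i < length (map set_monomial Cs :: ('v, 'k) mpoly list)"
    then show "\<exists>Z\<subseteq>X. colon_ideal X (genideal (poly_ring X) (set (take i (map set_monomial Cs))))
        (map set_monomial Cs ! i) = (genideal (poly_ring X) (Var ` Z) :: ('v, 'k) mpoly set)"
      using step[of i] by (metis length_map)
  qed
  moreover have "set_monomial ` set Cs = (set_monomial ` F :: ('v, 'k) mpoly set) \<longleftrightarrow> set Cs = F"
    using inj_on_image_eq_iff[OF inj, of "set Cs" F] Cs F by blast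
  moreover have "distinct (map (set_monomial :: _ \<Rightarrow> ('v, 'k) mpoly) Cs) \<longleftrightarrow> distinct Cs"
    using inj Cs by (auto simp: distinct_map intro: inj_on_subset)
  ultimately show ?thesis
    using minimal_monomial_generators_unique[OF X F anti, where 'k='k]
    unfolding linear_quotients_ordering_def by auto
qed


lemma (in graph) adj_sym: "u \<rightarrow>\<^bsub>G\<^esub> v \<Longrightarrow> v \<rightarrow>\<^bsub>G\<^esub> u"
  using sym_arcs by (auto simp: symmetric_def dest: symD)

lemma minimal_vertex_cover_iff:
  assumes "graph G"
  shows "minimal_vertex_cover G C \<longleftrightarrow> C \<subseteq> verts G \<and>
    (\<forall>u v. u \<rightarrow>\<^bsub>G\<^esub> v \<longrightarrow> u \<in> C \<or> v \<in> C) \<and> (\<forall>c\<in>C. \<exists>w. c \<rightarrow>\<^bsub>G\<^esub> w \<and> w \<notin> C)"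
    (is "_ \<longleftrightarrow> ?R")
proof
  interpret graph G by fact
  assume min: "minimal_vertex_cover G C"
  have "\<exists>w. c \<rightarrow>\<^bsub>G\<^esub> w \<and> w \<notin> C" if c: "c \<in> C" for c
  proof -
    have "\<not> vertex_cover G (C - {c})"
      using min c by (auto simp: minimal_vertex_cover_def)
    then obtain u v where uv: "u \<rightarrow>\<^bsub>G\<^esub> v" "u \<notin> C - {c}" "v \<notin> C - {c}"
      using min by (auto simp: minimal_vertex_cover_def vertex_cover_def)
    moreover have "u \<in> C \<or> v \<in> C"
      using min uv by (auto simp: minimal_vertex_cover_def vertex_cover_def)
    moreover have "u \<noteq> v" using uv adj_not_same by blast
    ultimately show ?thesis using adj_sym by blast
  qed
  with min show ?R by (auto simp: minimal_vertex_cover_def vertex_cover_def)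
next
  assume ?R
  then show "minimal_vertex_cover G C"
    unfolding minimal_vertex_cover_def vertex_cover_def by blast
qed

lemma vertex_cover_contains_minimal:
  assumes "finite C" "vertex_cover G C"
  obtains D where "D \<subseteq> C" "minimal_vertex_cover G D"
proof -
  let ?V = "{D. D \<subseteq> C \<and> vertex_cover G D}"
  have "finite ?V" "?V \<noteq> {}" using assms by auto
  from finite_has_minimal[OF this] obtain D
    where D: "D \<in> ?V" "\<forall>D'\<in>?V. D' \<subseteq> D \<longrightarrow> D = D'" by blast
  then have "D \<subseteq> C" "minimal_vertex_cover G D"
    unfolding minimal_vertex_cover_def by auto
  with that show thesis by blast
qed

lemma verts_remove_verts [simp]: "verts (remove_verts G A) = verts G - A"
  by (simp add: remove_verts_def)

context graph
begin

lemma adj_remove_verts: "u \<rightarrow>\<^bsub>remove_verts G A\<^esub> v \<longleftrightarrow> u \<rightarrow>\<^bsub>G\<^esub> v \<and> u \<notin> A \<and> v \<notin> A"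
  using adj_in_verts by (auto simp: remove_verts_def arcs_ends_def arc_to_ends_def image_iff)

lemma graph_remove_verts: "graph (remove_verts G A)"
proof -
  have ind: "induced_subgraph (remove_verts G A) G"
    unfolding remove_verts_def by (rule induced_induce) blast
  interpret H: digraph "remove_verts G A" by (rule digraphI_induced[OF ind])
  interpret H: sym_digraph "remove_verts G A" by (rule induced_graph_imp_graph[OF ind])
  show ?thesis by unfold_locales
qed

lemma minimal_vertex_cover_remove_verts:
  "minimal_vertex_cover (remove_verts G A) C \<longleftrightarrow> C \<subseteq> verts G - A \<and>
    (\<forall>u v. u \<rightarrow>\<^bsub>G\<^esub> v \<and> u \<notin> A \<and> v \<notin> A \<longrightarrow> u \<in> C \<or> v \<in> C) \<and>
    (\<forall>c\<in>C. \<exists>w. c \<rightarrow>\<^bsub>G\<^esub> w \<and> w \<notin> A \<and> w \<notin> C)"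
  unfolding minimal_vertex_cover_iff[OF graph_remove_verts] adj_remove_verts
  by (auto simp: subset_iff)

lemma minimal_vertex_cover_cases:
  assumes x: "x \<in> verts G"
  shows "minimal_vertex_cover G C \<longleftrightarrow>
    (\<exists>A. minimal_vertex_cover (remove_verts G (closed_nbhd G x)) A \<and> C = nbhd G x \<union> A) \<or>
    (\<exists>B. minimal_vertex_cover (remove_verts G {x}) B \<and> \<not> nbhd G x \<subseteq> B \<and> C = insert x B)"
    (is "_ \<longleftrightarrow> ?P \<or> ?Q")
proof
  note iff = minimal_vertex_cover_iff[OF graph_axioms]
  assume "minimal_vertex_cover G C"
  then have sub: "C \<subseteq> verts G" and cov: "\<And>u v. u \<rightarrow>\<^bsub>G\<^esub> v \<Longrightarrow> u \<in> C \<or> v \<in> C"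
    and priv: "\<And>c. c \<in> C \<Longrightarrow> \<exists>w. c \<rightarrow>\<^bsub>G\<^esub> w \<and> w \<notin> C"
    by (auto simp: iff)
  show "?P \<or> ?Q"
  proof (cases "x \<in> C")
    case False
    then have N: "nbhd G x \<subseteq> C" using cov by (auto simp: nbhd_def)
    have "minimal_vertex_cover (remove_verts G (closed_nbhd G x)) (C - nbhd G x)"
      unfolding minimal_vertex_cover_remove_verts
    proof (intro conjI ballI allI impI)
      show "C - nbhd G x \<subseteq> verts G - closed_nbhd G x"
        using False sub by (auto simp: closed_nbhd_def)
    next
      fix u v assume "u \<rightarrow>\<^bsub>G\<^esub> v \<and> u \<notin> closed_nbhd G x \<and> v \<notin> closed_nbhd G x"
      then show "u \<in> C - nbhd G x \<or> v \<in> C - nbhd G x"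
        using cov by (auto simp: closed_nbhd_def)
    next
      fix c assume c: "c \<in> C - nbhd G x"
      then obtain w where w: "c \<rightarrow>\<^bsub>G\<^esub> w" "w \<notin> C" using priv by blast
      then have "w \<noteq> x" using c adj_sym by (auto simp: nbhd_def)
      then show "\<exists>w. c \<rightarrow>\<^bsub>G\<^esub> w \<and> w \<notin> closed_nbhd G x \<and> w \<notin> C - nbhd G x"
        using w N by (auto simp: closed_nbhd_def)
    qed
    with N show ?thesis by blast
  next
    case True
    then obtain y where "y \<in> nbhd G x" "y \<notin> C" using priv by (auto simp: nbhd_def)
    then have "\<not> nbhd G x \<subseteq> C - {x}" by blast
    moreover have "minimal_vertex_cover (remove_verts G {x}) (C - {x})"
      unfolding minimal_vertex_cover_remove_verts
      using sub cov priv True by blast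
    ultimately show ?thesis using True by blast
  qed
next
  note iff = minimal_vertex_cover_iff[OF graph_axioms]
  have irr: "x \<notin> nbhd G x" using adj_not_same by (auto simp: nbhd_def)
  assume "?P \<or> ?Q"
  then show "minimal_vertex_cover G C"
  proof
    assume ?P
    then obtain A where mA: "minimal_vertex_cover (remove_verts G (closed_nbhd G x)) A"
      and C: "C = nbhd G x \<union> A" by blast
    from mA have A: "A \<subseteq> verts G - closed_nbhd G x"
      "\<And>u v. u \<rightarrow>\<^bsub>G\<^esub> v \<Longrightarrow> u \<notin> closed_nbhd G x \<Longrightarrow> v \<notin> closed_nbhd G x \<Longrightarrow> u \<in> A \<or> v \<in> A"
      "\<And>c. c \<in> A \<Longrightarrow> \<exists>w. c \<rightarrow>\<^bsub>G\<^esub> w \<and> w \<notin> closed_nbhd G x \<and> w \<notin> A"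
      by (simp_all add: minimal_vertex_cover_remove_verts)
    show ?thesis
      unfolding iff
    proof (intro conjI ballI allI impI)
      show "C \<subseteq> verts G" using A C adj_in_verts by (auto simp: nbhd_def)
    next
      fix u v assume "u \<rightarrow>\<^bsub>G\<^esub> v"
      then show "u \<in> C \<or> v \<in> C"
        using A(2)[of u v] adj_sym[of u v] unfolding C by (auto simp: closed_nbhd_def nbhd_def)
    next
      fix c assume "c \<in> C"
      then consider "c \<in> nbhd G x" | "c \<in> A" using C by blast
      then show "\<exists>w. c \<rightarrow>\<^bsub>G\<^esub> w \<and> w \<notin> C"
      proof cases
        case 1
        then have "c \<rightarrow>\<^bsub>G\<^esub> x" using adj_sym by (simp add: nbhd_def)
        moreover have "x \<notin> C" using irr A(1) C by (auto simp: closed_nbhd_def)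
        ultimately show ?thesis by blast
      next
        case 2
        then show ?thesis using A(3)[of c] C by (auto simp: closed_nbhd_def)
      qed
    qed
  next
    assume ?Q
    then obtain B y where mB: "minimal_vertex_cover (remove_verts G {x}) B"
      and C: "C = insert x B" and y: "y \<in> nbhd G x" "y \<notin> B" by blast
    from mB have B: "B \<subseteq> verts G - {x}"
      "\<And>u v. u \<rightarrow>\<^bsub>G\<^esub> v \<Longrightarrow> u \<noteq> x \<Longrightarrow> v \<noteq> x \<Longrightarrow> u \<in> B \<or> v \<in> B"
      "\<And>c. c \<in> B \<Longrightarrow> \<exists>w. c \<rightarrow>\<^bsub>G\<^esub> w \<and> w \<noteq> x \<and> w \<notin> B"
      by (simp_all add: minimal_vertex_cover_remove_verts)
    have "x \<rightarrow>\<^bsub>G\<^esub> y" "y \<notin> C" using y irr C by (auto simp: nbhd_def)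
    then show ?thesis unfolding iff using B x C by blast
  qed
qed

end

lemma filter_nth_take:
  assumes "k < length (filter P xs)"
  obtains j where "j < length xs" "filter P xs ! k = xs ! j"
    "take k (filter P xs) = filter P (take j xs)"
proof -
  have "\<exists>j<length xs. filter P xs ! k = xs ! j \<and> take k (filter P xs) = filter P (take j xs)"
    using assms
  proof (induction xs arbitrary: k)
    case (Cons a xs)
    consider "P a" "k = 0" | k' where "P a" "k = Suc k'" | "\<not> P a" by (cases k) auto
    then show ?case
    proof cases
      case 2
      then obtain j where "j < length xs" "filter P xs ! k' = xs ! j"
        "take k' (filter P xs) = filter P (take j xs)" using Cons.IH[of k'] Cons.prems by auto
      with 2 show ?thesis by (intro exI[of _ "Suc j"]) simp
    next
      case 3
      then obtain j where "j < length xs" "filter P xs ! k = xs ! j"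
        "take k (filter P xs) = filter P (take j xs)" using Cons.IH[of k] Cons.prems by auto
      with 3 show ?thesis by (intro exI[of _ "Suc j"]) simp
    qed auto
  qed simp
  with that show thesis by blast
qed

lemma linear_quotients_sets_cover:
  assumes "graph G" and x: "x \<in> verts G"
    and clique: "\<And>u v. u \<in> nbhd G x \<Longrightarrow> v \<in> nbhd G x \<Longrightarrow> u \<noteq> v \<Longrightarrow> u \<rightarrow>\<^bsub>G\<^esub> v"
    and Cs: "set Cs = Collect (minimal_vertex_cover (remove_verts G (closed_nbhd G x)))"
    and Ds: "set Ds = Collect (minimal_vertex_cover (remove_verts G {x}))"
    and lqC: "linear_quotients_sets (verts G - closed_nbhd G x) Cs"
    and lqD: "linear_quotients_sets (verts G - {x}) Ds"
  shows "linear_quotients_sets (verts G)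
    (map ((\<union>) (nbhd G x)) Cs @ map (insert x) (filter (\<lambda>D. \<not> nbhd G x \<subseteq> D) Ds))"
proof -
  interpret graph G by fact
  let ?N = "nbhd G x" and ?X = "verts G - closed_nbhd G x" and ?Y = "verts G - {x}"
  let ?Fs = "filter (\<lambda>D. \<not> ?N \<subseteq> D) Ds"
  let ?Ls = "map ((\<union>) ?N) Cs @ map (insert x) ?Fs"
  have N: "?N \<subseteq> ?Y" using adj_in_verts adj_not_same by (auto simp: nbhd_def)
  have C_sub: "C \<subseteq> ?X" if "C \<in> set Cs" for C
    using that unfolding Cs by (auto simp: minimal_vertex_cover_remove_verts)
  have D_sub: "D \<subseteq> ?Y" if "D \<in> set Ds" for D
    using that unfolding Ds by (auto simp: minimal_vertex_cover_remove_verts)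
  show ?thesis
    unfolding linear_quotients_sets_def
  proof (intro allI impI)
    fix i assume i: "i < length ?Ls"
    show "\<exists>Z\<subseteq>verts G. \<forall>S\<subseteq>verts G. (\<exists>C\<in>set (take i ?Ls). C \<subseteq> S \<union> ?Ls ! i) \<longleftrightarrow> S \<inter> Z \<noteq> {}"
    proof (cases "i < length Cs")
      case True
      then obtain Z where Z: "Z \<subseteq> ?X"
        "\<And>S. S \<subseteq> ?X \<Longrightarrow> (\<exists>C\<in>set (take i Cs). C \<subseteq> S \<union> Cs ! i) \<longleftrightarrow> S \<inter> Z \<noteq> {}"
        using lqC by (auto simp: linear_quotients_sets_def)
      have L: "?Ls ! i = ?N \<union> Cs ! i" "set (take i ?Ls) = (\<union>) ?N ` set (take i Cs)"
        using True by (simp_all add: nth_append take_map)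
      have "(\<exists>C\<in>set (take i ?Ls). C \<subseteq> S \<union> ?Ls ! i) \<longleftrightarrow> S \<inter> Z \<noteq> {}" if "S \<subseteq> verts G" for S
      proof -
        have "?N \<union> C \<subseteq> S \<union> (?N \<union> Cs ! i) \<longleftrightarrow> C \<subseteq> (S \<inter> ?X) \<union> Cs ! i"
          if "C \<in> set (take i Cs)" for C
          using C_sub[OF in_set_takeD[OF that]] by (auto simp: closed_nbhd_def)
        then have "(\<exists>C\<in>set (take i ?Ls). C \<subseteq> S \<union> ?Ls ! i) \<longleftrightarrow>
            (\<exists>C\<in>set (take i Cs). C \<subseteq> (S \<inter> ?X) \<union> Cs ! i)"
          unfolding L by (simp cong: bex_cong)
        also have "\<dots> \<longleftrightarrow> (S \<inter> ?X) \<inter> Z \<noteq> {}" by (rule Z) simp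
        also have "\<dots> \<longleftrightarrow> S \<inter> Z \<noteq> {}" using Z(1) by blast
        finally show ?thesis .
      qed
      then show ?thesis using Z(1) by blast
    next
      case False
      define k where "k = i - length Cs"
      have k: "i = length Cs + k" "k < length ?Fs" using False i by (simp_all add: k_def)
      from filter_nth_take[OF k(2)] obtain j where j: "j < length Ds" "?Fs ! k = Ds ! j"
        "take k ?Fs = filter (\<lambda>D. \<not> ?N \<subseteq> D) (take j Ds)" by blast
      define B where "B = Ds ! j"
      have L: "?Ls ! i = insert x B" "set (take i ?Ls) =
          (\<union>) ?N ` set Cs \<union> insert x ` {D \<in> set (take j Ds). \<not> ?N \<subseteq> D}"
        using k j by (auto simp: nth_append take_map B_def)
      have B_in: "B \<in> set Ds" using j by (simp add: B_def)
      have "?Fs ! k \<in> set ?Fs" using k(2) nth_mem by blast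
      then have "\<not> ?N \<subseteq> B" using j by (simp add: B_def)
      then obtain y where y: "y \<in> ?N" "y \<notin> B" by blast
      have B_cov: "u \<in> B \<or> v \<in> B" if "u \<rightarrow>\<^bsub>G\<^esub> v" "u \<noteq> x" "v \<noteq> x" for u v
        using B_in that unfolding Ds by (auto simp: minimal_vertex_cover_remove_verts)
      have N_B: "?N \<subseteq> insert y B" using clique[OF y(1)] B_cov y N by blast
      obtain Z where Z: "Z \<subseteq> ?Y"
        "\<And>S. S \<subseteq> ?Y \<Longrightarrow> (\<exists>D\<in>set (take j Ds). D \<subseteq> S \<union> B) \<longleftrightarrow> S \<inter> Z \<noteq> {}"
        using lqD j by (auto simp: linear_quotients_sets_def B_def)
      have y_quot: "\<exists>C\<in>set (take i ?Ls). C \<subseteq> S \<union> ?Ls ! i" if "y \<in> S" for S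
      proof -
        have "vertex_cover (remove_verts G (closed_nbhd G x)) (B - ?N)"
          using B_cov D_sub[OF B_in]
          by (auto simp: vertex_cover_def adj_remove_verts closed_nbhd_def)
        moreover have "finite (B - ?N)"
          using D_sub[OF B_in] finite_verts by (meson Diff_subset finite_subset order_trans)
        ultimately obtain A where "A \<subseteq> B - ?N"
          "minimal_vertex_cover (remove_verts G (closed_nbhd G x)) A"
          by (metis vertex_cover_contains_minimal)
        then have "A \<in> set Cs" "?N \<union> A \<subseteq> S \<union> ?Ls ! i"
          using Cs N_B that unfolding L by auto
        then show ?thesis unfolding L by blast
      qed
      have "(\<exists>C\<in>set (take i ?Ls). C \<subseteq> S \<union> ?Ls ! i) \<longleftrightarrow> S \<inter> insert y Z \<noteq> {}"
        if S: "S \<subseteq> verts G" for S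
      proof
        assume "\<exists>C\<in>set (take i ?Ls). C \<subseteq> S \<union> ?Ls ! i"
        then consider A where "?N \<union> A \<subseteq> S \<union> insert x B"
          | D where "D \<in> set (take j Ds)" "insert x D \<subseteq> S \<union> insert x B"
          unfolding L by blast
        then show "S \<inter> insert y Z \<noteq> {}"
        proof cases
          case 1
          then show ?thesis using y N by blast
        next
          case 2
          then have "D \<subseteq> (S \<inter> ?Y) \<union> B" using D_sub in_set_takeD by fast
          then have "(S \<inter> ?Y) \<inter> Z \<noteq> {}" using 2 Z(2)[of "S \<inter> ?Y"] by blast
          then show ?thesis by blast
        qed
      next
        assume "S \<inter> insert y Z \<noteq> {}"
        then consider "y \<in> S" | z where "z \<in> S" "z \<in> Z" by blast
        then show "\<exists>C\<in>set (take i ?Ls). C \<subseteq> S \<union> ?Ls ! i"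
        proof cases
          case 1
          then show ?thesis by (rule y_quot)
        next
          case 2
          then obtain D where D: "D \<in> set (take j Ds)" "D \<subseteq> {z} \<union> B"
            using Z(1) Z(2)[of "{z}"] by blast
          show ?thesis
          proof (cases "?N \<subseteq> D")
            case True
            then have "y = z" using y D by blast
            with 2 y_quot show ?thesis by blast
          next
            case False
            then have "insert x D \<in> set (take i ?Ls)" using D unfolding L by blast
            moreover have "insert x D \<subseteq> S \<union> ?Ls ! i" using D 2 unfolding L by blast
            ultimately show ?thesis by blast
          qed
        qed
      qed
      moreover have "insert y Z \<subseteq> verts G" using Z(1) y N by blast
      ultimately show ?thesis by blast
    qed
  qed
qed

lemma linear_quotients_ordering_cover_ideal:
  fixes Cs :: "'v set list"
  assumes "graph G" and "set Cs \<subseteq> Pow (verts G)"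
  shows "linear_quotients_ordering (verts G) (cover_ideal G)
      (map set_monomial Cs :: ('v, 'k::field) mpoly list) \<longleftrightarrow>
    distinct Cs \<and> set Cs = Collect (minimal_vertex_cover G) \<and>
    linear_quotients_sets (verts G) Cs"
proof -
  interpret graph G by fact
  have "(cover_ideal G :: ('v, 'k) mpoly set) =
      genideal (poly_ring (verts G)) (set_monomial ` Collect (minimal_vertex_cover G))"
    by (simp add: cover_ideal_def image_Collect)
  moreover have mvc: "Collect (minimal_vertex_cover G) \<subseteq> Pow (verts G)"
    by (auto simp: minimal_vertex_cover_def vertex_cover_def)
  moreover have anti: "\<forall>C\<in>Collect (minimal_vertex_cover G). \<forall>D\<in>Collect (minimal_vertex_cover G).
      C \<subseteq> D \<longrightarrow> C = D"
    by (auto simp: minimal_vertex_cover_def)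
  ultimately show ?thesis
    using linear_quotients_ordering_set_monomials[OF finite_verts mvc anti assms(2)] by simp
qed

lemma linear_quotients_ordering_cover_idealE:
  fixes ms :: "('v, 'k::field) mpoly list"
  assumes "graph G" and lq: "linear_quotients_ordering (verts G) (cover_ideal G) ms"
  obtains Cs where "ms = map set_monomial Cs" "distinct Cs"
    "set Cs = Collect (minimal_vertex_cover G)" "linear_quotients_sets (verts G) Cs"
proof -
  interpret graph G by fact
  have mvc: "Collect (minimal_vertex_cover G) \<subseteq> Pow (verts G)"
    by (auto simp: minimal_vertex_cover_def vertex_cover_def)
  have "minimal_monomial_generators (verts G)
      (genideal (poly_ring (verts G)) (set_monomial ` Collect (minimal_vertex_cover G))) (set ms)"
    using lq by (simp add: linear_quotients_ordering_def cover_ideal_def image_Collect)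
  then have "set ms = set_monomial ` Collect (minimal_vertex_cover G)"
    by (subst (asm) minimal_monomial_generators_unique[OF finite_verts mvc])
       (auto simp: minimal_vertex_cover_def)
  then have "ms \<in> lists (set_monomial ` Collect (minimal_vertex_cover G))" by auto
  then obtain Cs where "Cs \<in> lists (Collect (minimal_vertex_cover G))" "ms = map set_monomial Cs"
    unfolding lists_image by blast
  then have Cs: "set Cs \<subseteq> Collect (minimal_vertex_cover G)" "ms = map set_monomial Cs" by auto
  with mvc have "set Cs \<subseteq> Pow (verts G)" by blast
  from linear_quotients_ordering_cover_ideal[OF assms(1) this, where 'k='k] lq
  have "distinct Cs \<and> set Cs = Collect (minimal_vertex_cover G) \<and> linear_quotients_sets (verts G) Cs"
    by (simp add: Cs(2))
  then show thesis using that Cs(2) by blast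
qed

theorem corollary3p5:
  fixes G :: "('v, 'e) pre_digraph"
    and x :: 'v
    and As Bs :: "('v, 'k::field) mpoly list"
  assumes "graph G"
    and "chordal G"
    and "x \<in> verts G"
    and "\<exists>n \<ge> 2. complete_digraph n (G \<restriction> closed_nbhd G x)"
    and "linear_quotients_ordering (verts G - closed_nbhd G x)
           (cover_ideal (remove_verts G (closed_nbhd G x))) As"
    and "linear_quotients_ordering (verts G - {x}) (cover_ideal (remove_verts G {x})) Bs"
  shows "linear_quotients_ordering (verts G) (cover_ideal G)
           (map (\<lambda>A. set_monomial (nbhd G x) * A) As @
            map (\<lambda>B. Var x * B) (filter (\<lambda>B. \<not> nbhd G x \<subseteq> monomial_set B) Bs))"
proof -
  interpret graph G by fact
  let ?N = "nbhd G x"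
  obtain Cs where Cs: "As = map set_monomial Cs" "distinct Cs"
    "set Cs = Collect (minimal_vertex_cover (remove_verts G (closed_nbhd G x)))"
    "linear_quotients_sets (verts G - closed_nbhd G x) Cs"
    using linear_quotients_ordering_cover_idealE[OF graph_remove_verts, of "closed_nbhd G x" As] assms(5)
    by auto
  obtain Ds where Ds: "Bs = map set_monomial Ds" "distinct Ds"
    "set Ds = Collect (minimal_vertex_cover (remove_verts G {x}))"
    "linear_quotients_sets (verts G - {x}) Ds"
    using linear_quotients_ordering_cover_idealE[OF graph_remove_verts, of "{x}" Bs] assms(6)
    by auto
  have N: "?N \<subseteq> verts G - {x}" using adj_in_verts adj_not_same by (auto simp: nbhd_def)
  have C_sub: "C \<subseteq> verts G - closed_nbhd G x" if "C \<in> set Cs" for C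
    using that unfolding Cs by (auto simp: minimal_vertex_cover_remove_verts)
  have D_sub: "D \<subseteq> verts G - {x}" if "D \<in> set Ds" for D
    using that unfolding Ds by (auto simp: minimal_vertex_cover_remove_verts)
  have fin: "finite S" if "S \<subseteq> verts G - T" for S T
    using that finite_verts by (meson Diff_subset finite_subset order_trans)
  have C_disj: "?N \<inter> C = {}" "x \<notin> C" if "C \<in> set Cs" for C
    using C_sub[OF that] by (auto simp: closed_nbhd_def)
  have x_notin: "x \<notin> D" if "D \<in> set Ds" for D
    using D_sub[OF that] by blast
  note fin_C = fin[OF C_sub] and fin_D = fin[OF D_sub]
  have clique: "u \<rightarrow>\<^bsub>G\<^esub> v" if "u \<in> ?N" "v \<in> ?N" "u \<noteq> v" for u v
  proof -
    have "(u, v) \<in> arcs_ends (G \<restriction> closed_nbhd G x)"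
      using assms(4) that by (auto simp: complete_digraph_def closed_nbhd_def)
    then show ?thesis by (rule dominates_induce_subgraphD)
  qed
  let ?Fs = "filter (\<lambda>D. \<not> ?N \<subseteq> D) Ds"
  let ?Ls = "map ((\<union>) ?N) Cs @ map (insert x) ?Fs"
  have "map (\<lambda>A. set_monomial ?N * A) As = map set_monomial (map ((\<union>) ?N) Cs)"
    unfolding Cs(1) by (simp add: set_monomial_mult[OF fin[OF N] fin_C C_disj(1)])
  moreover have "filter (\<lambda>B. \<not> ?N \<subseteq> monomial_set B) Bs = map set_monomial ?Fs"
    unfolding Ds(1) filter_map comp_def
    by (simp add: monomial_set_set_monomial[OF fin_D] cong: filter_cong)
  moreover have "map (\<lambda>B. Var x * B) (map set_monomial ?Fs) = map set_monomial (map (insert x) ?Fs)"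
    by (simp add: Var_mult_set_monomial[OF fin_D x_notin])
  ultimately have eq: "map (\<lambda>A. set_monomial ?N * A) As @
      map (\<lambda>B. Var x * B) (filter (\<lambda>B. \<not> ?N \<subseteq> monomial_set B) Bs) = map set_monomial ?Ls"
    by simp
  have "distinct ?Ls"
  proof -
    have "inj_on ((\<union>) ?N) (set Cs)"
    proof (rule inj_onI)
      fix C D assume "C \<in> set Cs" "D \<in> set Cs" "?N \<union> C = ?N \<union> D"
      then show "C = D" using C_disj(1)[of C] C_disj(1)[of D] by blast
    qed
    moreover have "inj_on (insert x) (set ?Fs)"
    proof (rule inj_onI)
      fix C D assume "C \<in> set ?Fs" "D \<in> set ?Fs" "insert x C = insert x D"
      moreover from this have "x \<notin> C" "x \<notin> D" using x_notin by simp_all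
      ultimately show "C = D" by (simp add: insert_ident)
    qed
    moreover have "(\<union>) ?N ` set Cs \<inter> insert x ` set ?Fs = {}"
      using C_disj(2) N by blast
    ultimately show ?thesis using Cs(2) Ds(2) by (simp add: distinct_map)
  qed
  moreover have set_Ls: "set ?Ls = Collect (minimal_vertex_cover G)"
    using minimal_vertex_cover_cases[OF assms(3)] Cs(3) Ds(3) by (simp add: set_eq_iff image_iff Bex_def conj_assoc)
  moreover have "linear_quotients_sets (verts G) ?Ls"
    by (rule linear_quotients_sets_cover[OF assms(1,3) clique Cs(3) Ds(3) Cs(4) Ds(4)])
  moreover have "set ?Ls \<subseteq> Pow (verts G)"
    unfolding set_Ls by (auto simp: minimal_vertex_cover_def vertex_cover_def)
  ultimately show ?thesis
    unfolding eq using linear_quotients_ordering_cover_ideal[OF assms(1)] by blast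
qed

end
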